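(* There is no $2$-geodetic digraph with minimum out-degree at least $2$ and order $9$ whose in-degree sequence is $(1,1,1,2,2,2,3,3,3)$.
   Context: A digraph is $2$-geodetic if for any two vertices $u,v$ there is at most one directed walk from $u$ to $v$ of length at most $2$. The in-degree sequence is the list of in-degrees in non-decreasing order. *)

theory Defs
  imports "Graph_Theory.Digraph" "Graph_Theory.Arc_Walk" "HOL-Library.Multiset"
begin

text \<open>
  Walks are arc walks, so vertices and arcs may be repeated, and the empty arc list is the
  walk of length 0 from a vertex to itself.
\<close>

definition geodetic :: "nat \<Rightarrow> ('a, 'b) pre_digraph \<Rightarrow> bool" where
  "geodetic k G \<longleftrightarrow>
     (\<forall>u\<in>verts G. \<forall>v\<in>verts G. \<exists>\<^sub>\<le>\<^sub>1 p. pre_digraph.awalk G u p v \<and> length p \<le> k)"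

definition min_out_degree :: "('a, 'b) pre_digraph \<Rightarrow> nat" where
  "min_out_degree G = Min (out_degree G ` verts G)"

definition in_degree_sequence :: "('a, 'b) pre_digraph \<Rightarrow> nat list" where
  "in_degree_sequence G =
     sorted_list_of_multiset (image_mset (in_degree G) (mset_set (verts G)))"

end

theory Submission
  imports Defs
begin

text \<open>
  Since the in-degrees sum to \<open>18 = 2 \<cdot> 9\<close>, every out-degree is exactly 2. Number the vertices by
  non-decreasing in-degree. Being 2-geodetic forbids closed walks of length 2, a walk of length 2
  parallel to an arc, and two walks of length 2 with the same ends. Together with the degree
  conditions, these are finitely many clauses in the 81 Boolean variables ``there is an arc from
  \<open>i\<close> to \<open>j\<close>'', and a SAT refutation shows them to be inconsistent; no symmetry has to be broken.
\<close>

section \<open>Consequences of the geodetic property for adjacency\<close>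

lemma (in wf_digraph) geodetic_awalk_unique:
  assumes "geodetic k G" "awalk u p v" "length p \<le> k" "awalk u q v" "length q \<le> k"
  shows "p = q"
proof -
  have "u \<in> verts G" "v \<in> verts G"
    using assms(2) by auto
  then show ?thesis
    using assms unfolding geodetic_def Uniq_def by blast
qed

lemma (in wf_digraph) dominates_awalk:
  assumes "u \<rightarrow> v"
  obtains e where "awalk u [e] v"
proof -
  obtain e where "e \<in> arcs G" "tail G e = u" "head G e = v"
    using assms by (auto simp: arcs_ends_conv)
  then show thesis
    using that[of e] by (auto simp: awalk_simps)
qed

text \<open>The equation \<open>head G e = v\<close> keeps track of the middle vertex, so that equal
  walks can later be seen to have equal middle vertices.\<close>

lemma (in wf_digraph) dominates_dominates_awalk:
  assumes "u \<rightarrow> v" "v \<rightarrow> w"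
  obtains e f where "awalk u [e, f] w" "head G e = v"
proof -
  obtain e f where "e \<in> arcs G" "tail G e = u" "head G e = v"
    and "f \<in> arcs G" "tail G f = v" "head G f = w"
    using assms by (auto simp: arcs_ends_conv)
  then show thesis
    using that[of e f] by (auto simp: awalk_simps)
qed

text \<open>Going to \<open>v\<close> and back would be a second walk from \<open>u\<close> to
  itself, next to the empty one. The case \<open>u = v\<close> is covered, so loops are excluded
  too.\<close>

lemma (in wf_digraph) geodetic_2_asym:
  assumes "geodetic 2 G" "u \<rightarrow> v"
  shows "\<not> v \<rightarrow> u"
proof
  assume "v \<rightarrow> u"
  with assms(2) obtain e f where walk: "awalk u [e, f] u"
    by (rule dominates_dominates_awalk)
  then have "awalk u [] u"
    by (auto simp: awalk_Nil_iff)
  then have "[e, f] = []"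
    by (rule geodetic_awalk_unique[OF assms(1) walk, rotated]) simp_all
  then show False
    by simp
qed

text \<open>Walks of lengths 1 and 2 with the same ends are distinct and both short enough to be
  counted.\<close>

lemma (in wf_digraph) geodetic_2_no_shortcut:
  assumes "geodetic 2 G" "u \<rightarrow> v" "v \<rightarrow> w"
  shows "\<not> u \<rightarrow> w"
proof
  assume "u \<rightarrow> w"
  then obtain g where g: "awalk u [g] w"
    by (rule dominates_awalk)
  obtain e f where "awalk u [e, f] w"
    using assms(2,3) by (rule dominates_dominates_awalk)
  then have "[e, f] = [g]"
    by (rule geodetic_awalk_unique[OF assms(1) _ _ g]) simp_all
  then show False
    by simp
qed

lemma (in wf_digraph) geodetic_2_unique_middle:
  assumes "geodetic 2 G" "u \<rightarrow> v" "v \<rightarrow> w" "u \<rightarrow> v'" "v' \<rightarrow> w"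
  shows "v = v'"
proof -
  obtain e f where "awalk u [e, f] w" "head G e = v"
    using assms(2,3) by (rule dominates_dominates_awalk)
  moreover obtain e' f' where "awalk u [e', f'] w" "head G e' = v'"
    using assms(4,5) by (rule dominates_dominates_awalk)
  ultimately show ?thesis
    using geodetic_awalk_unique[OF assms(1), of u "[e, f]" w "[e', f']"] by simp
qed

section \<open>Degrees and the in-degree sequence\<close>

lemma (in nomulti_digraph) in_degree_eq_card_adj: "in_degree G v = card {u. u \<rightarrow> v}"
proof -
  \<comment> \<open>Without parallel arcs, an arc into \<open>v\<close> is determined by its
    tail.\<close>
  have "bij_betw (tail G) (in_arcs G v) {u. u \<rightarrow> v}"
    by (auto simp: bij_betw_def inj_on_def arcs_ends_conv arc_to_ends_def intro: no_multi_arcs)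
  then show ?thesis
    unfolding in_degree_def by (rule bij_betw_same_card)
qed

lemma (in nomulti_digraph) out_degree_eq_card_adj: "out_degree G u = card {v. u \<rightarrow> v}"
proof -
  have "bij_betw (head G) (out_arcs G u) {v. u \<rightarrow> v}"
    by (auto simp: bij_betw_def inj_on_def arcs_ends_conv arc_to_ends_def intro: no_multi_arcs)
  then show ?thesis
    unfolding out_degree_def by (rule bij_betw_same_card)
qed

text \<open>Double counting: every arc has exactly one head, and it is a vertex.\<close>

lemma (in fin_digraph) sum_in_degree: "(\<Sum>v\<in>verts G. in_degree G v) = card (arcs G)"
proof -
  have "(\<Sum>v\<in>verts G. card {e \<in> arcs G. head G e = v}) = 1 * card (arcs G)"
  proof (rule sum_multicount; (intro ballI)?)
    fix e
    assume "e \<in> arcs G"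
    then have "{v \<in> verts G. head G e = v} = {head G e}"
      by auto
    then show "card {v \<in> verts G. head G e = v} = 1"
      by simp
  qed simp_all
  then show ?thesis
    by (simp add: in_degree_def in_arcs_def)
qed

lemma (in fin_digraph) sum_out_degree: "(\<Sum>v\<in>verts G. out_degree G v) = card (arcs G)"
proof -
  have "(\<Sum>v\<in>verts G. card {e \<in> arcs G. tail G e = v}) = 1 * card (arcs G)"
  proof (rule sum_multicount; (intro ballI)?)
    fix e
    assume "e \<in> arcs G"
    then have "{v \<in> verts G. tail G e = v} = {tail G e}"
      by auto
    then show "card {v \<in> verts G. tail G e = v} = 1"
      by simp
  qed simp_all
  then show ?thesis
    by (simp add: out_degree_def out_arcs_def)
qed

lemma sum_list_in_degree_sequence:
  "sum_list (in_degree_sequence G) = (\<Sum>v\<in>verts G. in_degree G v)"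
proof -
  have "sum_list (in_degree_sequence G) = sum_mset (mset (in_degree_sequence G))"
    by (simp add: sum_mset_sum_list)
  then show ?thesis
    by (simp add: in_degree_sequence_def sum_unfold_sum_mset)
qed

text \<open>Sorting any enumeration of the vertices by in-degree works: mapping
  \<open>in_degree G\<close> over the result gives a sorted list with the right multiset of
  entries.\<close>

lemma in_degree_sequence_enumeration:
  assumes "finite (verts G)"
  obtains xs where "distinct xs" "set xs = verts G" "map (in_degree G) xs = in_degree_sequence G"
proof -
  obtain ys where ys: "distinct ys" "set ys = verts G"
    using finite_distinct_list[OF assms] by blast
  have "image_mset (in_degree G) (mset_set (verts G)) = mset (map (in_degree G) ys)"
    using ys by (metis mset_map mset_set_set)
  then have "in_degree_sequence G = sort (map (in_degree G) ys)"
    unfolding in_degree_sequence_def by (simp only: sorted_list_of_multiset_mset)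
  also have "\<dots> = map (in_degree G) (sort_key (in_degree G) ys)"
    by (rule properties_for_sort) simp_all
  finally show thesis
    using that[of "sort_key (in_degree G) ys"] ys by simp
qed

section \<open>Inconsistency of the clauses\<close>

lemma ex_notin_if_card_less:
  assumes "card B < card A" "finite B"
  shows "\<exists>x\<in>A. x \<notin> B"
  using assms by (metis card_mono not_le subsetI)

text \<open>As a rewrite rule this peels off one index at a time, turning a bounded quantifier into
  a finite conjunction.\<close>

lemma all_less_numeral:
  "(\<forall>i<numeral k. P i) \<longleftrightarrow> P (pred_numeral k) \<and> (\<forall>i<pred_numeral k. P i)"
  by (simp add: numeral_eq_Suc All_less_Suc)

lemma ex_less_numeral:
  "(\<exists>i<numeral k. P i) \<longleftrightarrow> P (pred_numeral k) \<or> (\<exists>i<pred_numeral k. P i)"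
  by (simp add: numeral_eq_Suc Ex_less_Suc)

text \<open>Only \<open>unique_middle\<close> bounds its indices: its conclusion compares indices,
  and in the application an index is determined by its vertex only below 9.\<close>

lemma no_adjacency_matrix:
  fixes E :: "nat \<Rightarrow> nat \<Rightarrow> bool"
  assumes asym: "\<And>i j. E i j \<Longrightarrow> \<not> E j i"
    and no_shortcut: "\<And>i j k. E i j \<Longrightarrow> E j k \<Longrightarrow> \<not> E i k"
    and unique_middle: "\<And>i j k l. j < 9 \<Longrightarrow> k < 9 \<Longrightarrow> E i j \<Longrightarrow> E j l \<Longrightarrow> E i k \<Longrightarrow> E k l \<Longrightarrow>
      j = k"
    and out: "\<And>i. i < 9 \<Longrightarrow> card {j. j < 9 \<and> E i j} = 2"
    and inn: "\<And>i. i < 9 \<Longrightarrow> card {j. j < 9 \<and> E j i} = [1, 1, 1, 2, 2, 2, 3, 3, 3] ! i"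
  shows False
proof -
  have in1: "card {j. j < 9 \<and> E j i} = 1" if "i < 3" for i
    using inn[of i] that by (auto simp: less_Suc_eq numeral_3_eq_3)
  have in2: "card {j. j < 9 \<and> E j i} = 2" if "i \<in> {3, 4, 5}" for i
    using inn[of i] that by auto
  have in3: "card {j. j < 9 \<and> E j i} = 3" if "i \<in> {6, 7, 8}" for i
    using inn[of i] that by auto

  have irr: "\<forall>i<9. \<not> E i i"
    using asym by blast
  have asym': "\<forall>i<9. \<forall>j<9. E i j \<longrightarrow> \<not> E j i"
    using asym by blast
  have no_shortcut': "\<forall>i<9. \<forall>j<9. \<forall>k<9. E i j \<longrightarrow> E j k \<longrightarrow> \<not> E i k"
    using no_shortcut by blast
  \<comment> \<open>The condition is symmetric in the two middle indices, so \<open>k < j\<close>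
    avoids duplicate clauses.\<close>
  have unique_middle':
    "\<forall>i<9. \<forall>l<9. \<forall>j<9. \<forall>k<j. E i j \<longrightarrow> E j l \<longrightarrow> E i k \<longrightarrow> \<not> E k l"
    using unique_middle by (metis less_trans less_irrefl)

  \<comment> \<open>A lower bound m on a count becomes clauses as follows: whichever m - 1 indices
    are excluded, possibly with repetition, some other index satisfies \<open>P\<close>.\<close>
  have ge1: "\<exists>j<9. P j" if "card {j::nat. j < 9 \<and> P j} \<ge> 1" for P
    using ex_notin_if_card_less[of "{}" "{j. j < 9 \<and> P j}"] that by auto
  have ge2: "\<exists>k<9. k \<noteq> j \<and> P k" if "card {j::nat. j < 9 \<and> P j} \<ge> 2" for P j
    using ex_notin_if_card_less[of "{j}" "{j. j < 9 \<and> P j}"] that by auto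
  have ge3: "\<exists>l<9. l \<noteq> j \<and> l \<noteq> k \<and> P l" if "card {j::nat. j < 9 \<and> P j} \<ge> 3" for P j k
  proof -
    have "card {j, k} < 3"
      by (simp add: card_insert_if)
    then show ?thesis
      using ex_notin_if_card_less[of "{j, k}" "{j. j < 9 \<and> P j}"] that by auto
  qed
  \<comment> \<open>An upper bound m says that no m + 1 distinct indices satisfy \<open>P\<close>;
    taking them in decreasing order lists each set once.\<close>
  have le1: "\<forall>j<9. \<forall>k<j. \<not> (P j \<and> P k)" if "card {j::nat. j < 9 \<and> P j} \<le> 1" for P
  proof (intro allI impI notI)
    fix j k :: nat
    assume "j < 9" "k < j" "P j \<and> P k"
    then have "{j, k} \<subseteq> {j. j < 9 \<and> P j}" "card {j, k} = 2"
      by auto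
    then show False
      using that card_mono[of "{j. j < 9 \<and> P j}" "{j, k}"] by simp
  qed
  have le2: "\<forall>j<9. \<forall>k<j. \<forall>l<k. \<not> (P j \<and> P k \<and> P l)"
    if "card {j::nat. j < 9 \<and> P j} \<le> 2" for P
  proof (intro allI impI notI)
    fix j k l :: nat
    assume "j < 9" "k < j" "l < k" "P j \<and> P k \<and> P l"
    then have "{j, k, l} \<subseteq> {j. j < 9 \<and> P j}" "card {j, k, l} = 3"
      by auto
    then show False
      using that card_mono[of "{j. j < 9 \<and> P j}" "{j, k, l}"] by simp
  qed

  have out_ge: "\<forall>i<9. \<forall>j<9. \<exists>k<9. k \<noteq> j \<and> E i k"
    by (rule allI, rule impI, rule allI, rule impI, rule ge2) (simp add: out)
  have out_le: "\<forall>i<9. \<forall>j<9. \<forall>k<j. \<forall>l<k. \<not> (E i j \<and> E i k \<and> E i l)"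
    by (rule allI, rule impI, rule le2) (simp add: out)
  have in1_ge: "\<forall>i<3. \<exists>j<9. E j i"
    by (rule allI, rule impI, rule ge1) (simp add: in1)
  have in1_le: "\<forall>i<3. \<forall>j<9. \<forall>k<j. \<not> (E j i \<and> E k i)"
    by (rule allI, rule impI, rule le1) (simp add: in1)
  have in2_ge: "\<forall>i\<in>{3, 4, 5}. \<forall>j<9. \<exists>k<9. k \<noteq> j \<and> E k i"
    by (rule ballI, rule allI, rule impI, rule ge2) (simp add: in2)
  have in2_le: "\<forall>i\<in>{3, 4, 5}. \<forall>j<9. \<forall>k<j. \<forall>l<k. \<not> (E j i \<and> E k i \<and> E l i)"
    by (rule ballI, rule le2) (simp add: in2)
  have in3_ge: "\<forall>i\<in>{6, 7, 8}. \<forall>j<9. \<forall>k<9. \<exists>l<9. l \<noteq> j \<and> l \<noteq> k \<and> E l i"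
    by (rule ballI, rule allI, rule impI, rule allI, rule impI, rule ge3) (simp add: in3)

  \<comment> \<open>Simplification now makes every condition propositional in the atoms
    \<open>E i j\<close>; rewriting with \<open>irr\<close> removes the nine diagonal atoms.\<close>
  note all_less_numeral [simp] ex_less_numeral [simp]
  note irr [simplified, simp]
  note clauses = asym'[simplified] no_shortcut'[simplified] unique_middle'[simplified]
    out_ge[simplified] out_le[simplified] in1_ge[simplified] in1_le[simplified]
    in2_ge[simplified] in2_le[simplified] in3_ge[simplified]
  show False
    using clauses by sat
qed

section \<open>From the digraph to its adjacency matrix\<close>

theorem theorem9:
  shows "\<not> (\<exists>G :: ('a, 'b) pre_digraph.
    digraph G \<and> geodetic 2 G \<and> min_out_degree G \<ge> 2 \<and> card (verts G) = 9 \<and>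
    in_degree_sequence G = [1, 1, 1, 2, 2, 2, 3, 3, 3])"
proof
  assume "\<exists>G :: ('a, 'b) pre_digraph.
    digraph G \<and> geodetic 2 G \<and> min_out_degree G \<ge> 2 \<and> card (verts G) = 9 \<and>
    in_degree_sequence G = [1, 1, 1, 2, 2, 2, 3, 3, 3]"
  then obtain G :: "('a, 'b) pre_digraph" where "digraph G"
    and geo: "geodetic 2 G" and min: "min_out_degree G \<ge> 2" and card: "card (verts G) = 9"
    and seq: "in_degree_sequence G = [1, 1, 1, 2, 2, 2, 3, 3, 3]"
    by blast
  interpret digraph G by fact

  have out_ge: "out_degree G v \<ge> 2" if "v \<in> verts G" for v
  proof -
    have "min_out_degree G \<le> out_degree G v"
      unfolding min_out_degree_def using that by (intro Min_le) auto
    then show ?thesis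
      using min by simp
  qed
  \<comment> \<open>Both sides are 18. As the terms on the left are at most those on the right,
    equality holds term by term.\<close>
  have "(\<Sum>v\<in>verts G. 2) = (\<Sum>v\<in>verts G. out_degree G v)"
    using sum_list_in_degree_sequence[of G] sum_in_degree sum_out_degree by (simp add: seq card)
  then have out: "out_degree G v = 2" if "v \<in> verts G" for v
    using sum_mono_inv[of "\<lambda>_. 2" "verts G" "out_degree G" v, OF _ out_ge that finite_verts] by simp

  obtain xs where xs: "distinct xs" "set xs = verts G"
    and deg: "map (in_degree G) xs = in_degree_sequence G"
    using in_degree_sequence_enumeration[OF finite_verts] .
  have len: "length xs = 9"
    using distinct_card[OF xs(1)] unfolding xs(2) card by simp
  have nth_bij: "bij_betw ((!) xs) {..<9} (verts G)"
    by (rule bij_betw_nth) (simp_all add: xs len)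
  \<comment> \<open>This carries counts of neighbours over to counts of indices; neighbours are
    always vertices, as the premise on \<open>P\<close> demands.\<close>
  have card_index: "card {j. j < 9 \<and> P (xs ! j)} = card {v. P v}"
    if "\<And>v. P v \<Longrightarrow> v \<in> verts G" for P
  proof -
    have "bij_betw ((!) xs) {j \<in> {..<9}. P (xs ! j)} {v \<in> verts G. P v}"
      using nth_bij by (auto simp: bij_betw_def inj_on_def)
    then have "card {j \<in> {..<9}. P (xs ! j)} = card {v \<in> verts G. P v}"
      by (rule bij_betw_same_card)
    moreover have "{v \<in> verts G. P v} = {v. P v}"
      using that by blast
    ultimately show ?thesis
      by simp
  qed

  show False
  proof (rule no_adjacency_matrix[of "\<lambda>i j. xs ! i \<rightarrow>\<^bsub>G\<^esub> xs ! j"])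
    fix i j k l :: nat
    assume "j < 9" "k < 9" "xs ! i \<rightarrow>\<^bsub>G\<^esub> xs ! j" "xs ! j \<rightarrow>\<^bsub>G\<^esub> xs ! l" "xs ! i \<rightarrow>\<^bsub>G\<^esub> xs ! k" "xs ! k \<rightarrow>\<^bsub>G\<^esub> xs ! l"
    then have "xs ! j = xs ! k"
      using geodetic_2_unique_middle[OF geo] by blast
    then show "j = k"
      using \<open>j < 9\<close> \<open>k < 9\<close> xs(1) len by (simp add: nth_eq_iff_index_eq)
  next
    fix i :: nat
    assume "i < 9"
    then have "xs ! i \<in> set xs" and "map (in_degree G) xs ! i = in_degree G (xs ! i)"
      using len by simp_all
    then have "xs ! i \<in> verts G" and "in_degree G (xs ! i) = [1, 1, 1, 2, 2, 2, 3, 3, 3] ! i"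
      unfolding deg seq xs(2) by simp_all
    then show "card {j. j < 9 \<and> xs ! i \<rightarrow>\<^bsub>G\<^esub> xs ! j} = 2"
      and "card {j. j < 9 \<and> xs ! j \<rightarrow>\<^bsub>G\<^esub> xs ! i} = [1, 1, 1, 2, 2, 2, 3, 3, 3] ! i"
      using card_index[of "\<lambda>v. xs ! i \<rightarrow>\<^bsub>G\<^esub> v"] card_index[of "\<lambda>v. v \<rightarrow>\<^bsub>G\<^esub> xs ! i"] out
      by (simp_all add: in_degree_eq_card_adj out_degree_eq_card_adj adj_in_verts)
  qed (use geodetic_2_asym[OF geo] geodetic_2_no_shortcut[OF geo] in blast)+
qed

end
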